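(* For every integer $n\ge 0$, $$H_n(x,s|q)=(x-s\,\mathcal{D}_q)^n\cdot 1 .$$ Here $H_n(x,s|q)$ is the $n$-th moment $\mathcal{F}_{x,0,-s}(z^n)$, and $x-s\,\mathcal{D}_q$ is the operator $f(x)\mapsto x f(x)-s(\mathcal{D}_qf)(x)$ on polynomials in $x$, applied $n$ times to the constant polynomial $1$.
   Context: $x,s,q$ are indeterminates, and $[n]_q=\frac{1-q^n}{1-q}$. The Al-Salam-Chihara polynomials $P_n(z;a,b,c)$ are defined by $P_{-1}=0$, $P_0=1$ and $P_{n+1}(z;a,b,c)=(z-aq^n)P_n(z;a,b,c)-(c+bq^{n-1})[n]_qP_{n-1}(z;a,b,c)$ for $n\ge 0$. $\mathcal{F}_{a,b,c}$ is the linear functional on polynomials in $z$ determined by $\mathcal{F}_{a,b,c}(P_n(z;a,b,c))=\delta_{n,0}$ for all $n\ge 0$. The new $q$-Hermite polynomials are $H_n(x,s|q):=\mathcal{F}_{x,0,-s}(z^n)$. Thus $H_n(x,s|q)=\mathcal{F}(z^n)$, where $\mathcal{F}(P_n(z))=\delta_{n,0}$ and $P_{n+1}(z)=(z-xq^n)P_n(z)+s[n]_qP_{n-1}(z)$, $P_0=1$, $P_{-1}=0$. The $q$-derivative acts on polynomials in $x$ by $(\mathcal{D}_qf)(x)=\frac{f(x)-f(qx)}{(1-q)x}$. *)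

theory Defs
  imports "HOL-Computational_Algebra.Computational_Algebra"
begin

text \<open>
  Over a field \<open>'k\<close> containing \<open>q\<close>, polynomials in the indeterminate \<open>x\<close> have type
  \<open>'k poly\<close>, and polynomials in \<open>z\<close> with coefficients depending on \<open>x\<close> have type
  \<open>'k poly poly\<close>.
\<close>

definition q_bracket :: "'k::field \<Rightarrow> nat \<Rightarrow> 'k" where
  "q_bracket q n = (1 - q ^ n) / (1 - q)"

text \<open>
  For \<open>n = 0\<close> the recurrence has the term \<open>(c + b q\<^sup>-\<^sup>1) [0] P\<^sub>-\<^sub>1\<close>, which vanishes since
  \<open>P\<^sub>-\<^sub>1 = 0\<close>. This gives the separate second equation.
\<close>

fun al_salam_chihara ::
  "'k::field \<Rightarrow> 'k poly \<Rightarrow> 'k poly \<Rightarrow> 'k poly \<Rightarrow> nat \<Rightarrow> 'k poly poly" where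
  "al_salam_chihara q a b c 0 = 1"
| "al_salam_chihara q a b c (Suc 0) = [:0, 1:] - [:a:]"
| "al_salam_chihara q a b c (Suc (Suc n)) =
     ([:0, 1:] - [:smult (q ^ Suc n) a:]) * al_salam_chihara q a b c (Suc n)
     - smult (smult (q_bracket q (Suc n)) (c + smult (q ^ n) b)) (al_salam_chihara q a b c n)"

definition is_asc_functional ::
  "'k::field \<Rightarrow> 'k poly \<Rightarrow> 'k poly \<Rightarrow> 'k poly \<Rightarrow> ('k poly poly \<Rightarrow> 'k poly) \<Rightarrow> bool" where
  "is_asc_functional q a b c L \<longleftrightarrow>
     (\<forall>f g. L (f + g) = L f + L g) \<and> (\<forall>r f. L (smult r f) = r * L f) \<and>
     (\<forall>n. L (al_salam_chihara q a b c n) = (if n = 0 then 1 else 0))"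

definition asc_functional ::
  "'k::field \<Rightarrow> 'k poly \<Rightarrow> 'k poly \<Rightarrow> 'k poly \<Rightarrow> 'k poly poly \<Rightarrow> 'k poly" where
  "asc_functional q a b c = (THE L. is_asc_functional q a b c L)"

lemma al_salam_chihara_monic:
  "degree (al_salam_chihara q a b c n) = n \<and> coeff (al_salam_chihara q a b c n) n = 1"
proof (induction q a b c n rule: al_salam_chihara.induct)
  case (3 q a b c n)
  define P where "P = al_salam_chihara q a b c"
  define e where "e = smult (q ^ Suc n) a"
  define d where "d = smult (q_bracket q (Suc n)) (c + smult (q ^ n) b)"
  have deg: "degree (P n) = n" "degree (P (Suc n)) = Suc n" "coeff (P (Suc n)) (Suc n) = 1"
    using 3 by (auto simp: P_def)
  have eq: "P (Suc (Suc n)) = pCons 0 (P (Suc n)) - smult e (P (Suc n)) - smult d (P n)"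
    by (simp add: P_def e_def d_def algebra_simps)
  have 1: "coeff (P (Suc (Suc n))) (Suc (Suc n)) = 1"
    unfolding eq using deg by (simp add: coeff_eq_0)
  moreover have "coeff (P (Suc (Suc n))) i = 0" if "i > Suc (Suc n)" for i
    unfolding eq using deg that by (cases i) (simp_all add: coeff_eq_0)
  ultimately have "degree (P (Suc (Suc n))) = Suc (Suc n)"
    by (metis degree_le le_antisym le_degree one_neq_zero)
  with 1 show ?case by (simp only: P_def simp_thms)
qed auto

fun asc_moment ::
  "'k::field \<Rightarrow> 'k poly \<Rightarrow> 'k poly \<Rightarrow> 'k poly \<Rightarrow> nat \<Rightarrow> 'k poly" where
  "asc_moment q a b c n = (if n = 0 then 1 else 0)
     - (\<Sum>i<n. coeff (al_salam_chihara q a b c n) i * asc_moment q a b c i)"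

declare asc_moment.simps [simp del]

lemma asc_functional_ex1: "\<exists>!L. is_asc_functional q a b c L"
proof
  define P where "P = al_salam_chihara q a b c"
  define m where "m = asc_moment q a b c"
  define L where "L = (\<lambda>f. \<Sum>i\<le>degree f. coeff f i * m i)"
  have L: "L f = (\<Sum>i\<le>N. coeff f i * m i)" if "degree f \<le> N" for f N
    unfolding L_def using that
    by (intro sum.mono_neutral_left) (auto simp: coeff_eq_0)
  have add: "L (f + g) = L f + L g" for f g
  proof -
    let ?N = "max (degree f) (degree g)"
    have "L (f + g) = (\<Sum>i\<le>?N. coeff (f + g) i * m i)"
      by (intro L degree_add_le_max)
    then show ?thesis
      by (simp add: L[of f ?N] L[of g ?N] sum.distrib algebra_simps)
  qed
  have smult: "L (smult r f) = r * L f" for r f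
    by (subst L[of _ "degree f"]) (simp_all add: L_def sum_distrib_left mult.assoc degree_smult_le)
  have "L (P n) = (if n = 0 then 1 else 0)" for n
    by (subst L[of _ n])
      (use al_salam_chihara_monic[of q a b c n] asc_moment.simps[of q a b c n] in
        \<open>simp_all add: P_def m_def lessThan_Suc_atMost[symmetric]\<close>)
  with add smult show "is_asc_functional q a b c L"
    by (simp add: is_asc_functional_def P_def)
  fix M assume M: "is_asc_functional q a b c M"
  have M_add: "M (f + g) = M f + M g" and M_smult: "M (smult r f) = r * M f" for f g r
    using M by (auto simp: is_asc_functional_def)
  have M_0: "M 0 = 0" using M_smult[of 0 0] by simp
  have M_sum: "M (\<Sum>i\<in>A. h i) = (\<Sum>i\<in>A. M (h i))" for A :: "nat set" and h
    by (induction A rule: infinite_finite_induct) (auto simp: M_0 M_add)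
  have M_eq: "M f = (\<Sum>i\<le>degree f. coeff f i * M (monom 1 i))" for f
  proof -
    have "M f = M (\<Sum>i\<le>degree f. smult (coeff f i) (monom 1 i))"
      by (simp add: smult_monom poly_as_sum_of_monoms)
    then show ?thesis
      by (simp only: M_sum M_smult)
  qed
  have "M (monom 1 n) = m n" for n
  proof (induction n rule: less_induct)
    case (less n)
    have "(if n = 0 then 1 else 0) = M (P n)"
      using M by (simp add: is_asc_functional_def P_def)
    also have "\<dots> = (\<Sum>i<n. coeff (P n) i * M (monom 1 i)) + M (monom 1 n)"
      using al_salam_chihara_monic[of q a b c n]
      by (subst M_eq) (simp add: P_def lessThan_Suc_atMost[symmetric])
    also have "(\<Sum>i<n. coeff (P n) i * M (monom 1 i)) = (\<Sum>i<n. coeff (P n) i * m i)"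
      using less by simp
    finally show ?case
      using asc_moment.simps[of q a b c n] by (simp add: P_def m_def algebra_simps)
  qed
  then show "M = L"
    by (intro ext, subst M_eq) (simp add: L_def)
qed

definition new_q_hermite :: "'k::field \<Rightarrow> 'k \<Rightarrow> nat \<Rightarrow> 'k poly" where
  "new_q_hermite s q n = asc_functional q [:0, 1:] 0 [:- s:] ([:0, 1:] ^ n)"

definition q_deriv :: "'k::field \<Rightarrow> 'k poly \<Rightarrow> 'k poly" where
  "q_deriv q f = (f - pcompose f [:0, q:]) div [:0, 1 - q:]"

text \<open>The division in the definition of \<open>q_deriv\<close> is exact.\<close>

lemma q_deriv_mult:
  assumes "q \<noteq> 1"
  shows "[:0, 1 - q:] * q_deriv q f = f - pcompose f [:0, q:]"
proof -
  have "[:0, 1:] dvd f - pcompose f [:0, q:]"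
    using poly_eq_0_iff_dvd[of "f - pcompose f [:0, q:]" 0] by (simp add: poly_pcompose)
  then have "smult (1 - q) [:0, 1:] dvd f - pcompose f [:0, q:]"
    using assms by (subst smult_dvd_iff) auto
  then have "[:0, 1 - q:] dvd f - pcompose f [:0, q:]" by simp
  then show ?thesis
    unfolding q_deriv_def by (rule dvd_mult_div_cancel)
qed

text \<open>
  The field of rational functions in the indeterminates \<open>s\<close> and \<open>q\<close> over a field \<open>'a\<close>
  is \<open>'a poly poly fract\<close>, the inner polynomial variable being \<open>q\<close> and the outer one \<open>s\<close>.
\<close>

definition indet_q :: "'a::field poly poly fract" where
  "indet_q = Fract [:[:0, 1:]:] 1"

definition indet_s :: "'a::field poly poly fract" where
  "indet_s = Fract [:0, 1:] 1"

lemma indet_q_neq_1: "indet_q \<noteq> 1"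
  by (simp add: indet_q_def One_fract_def eq_fract one_pCons)

end

theory Submission
  imports Defs
begin

text \<open>
  Write \<open>A = x - s D\<^sub>q\<close> and \<open>(\<eta> f)(x) = f(q x)\<close>. The moment functional is the only
  \<open>k[x]\<close>-linear \<open>L\<close> with \<open>L(P\<^sub>n) = \<delta>\<^sub>n\<^sub>,\<^sub>0\<close>, so it suffices that the \<open>k[x]\<close>-linear
  functional \<open>\<Phi>\<close> with \<open>\<Phi>(z\<^sup>i) = A\<^sup>i 1\<close> also maps \<open>P\<^sub>n\<close> to \<open>\<delta>\<^sub>n\<^sub>,\<^sub>0\<close>.

  The obstacle is that \<open>A\<close> does not commute with the coefficients of \<open>P\<^sub>n\<close>, which depend on \<open>x\<close>.
  The \<open>q\<close>-Leibniz rule measures the failure: for \<open>f = \<Sum>\<^sub>i f\<^sub>i z\<^sup>i\<close>,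
  \<open>\<Phi>(z f) = A \<Phi>(f) + s \<Sum>\<^sub>i (D\<^sub>q f\<^sub>i) \<eta>(A\<^sup>i 1)\<close> (lemma \<open>power_functional_pCons_0\<close>).
  For \<open>f = P\<^sub>n\<close> the correction is again a value of \<open>\<Phi>\<close>, because the polynomials form an
  Appell-type sequence in \<open>x\<close>, namely \<open>D\<^sub>q P\<^sub>n = - [n]\<^sub>q \<eta> P\<^sub>n\<^sub>-\<^sub>1\<close> (lemma
  \<open>q_deriv_coeff_asc\<close>); it equals \<open>- s [n]\<^sub>q \<eta>(\<Phi>(P\<^sub>n\<^sub>-\<^sub>1))\<close>. The three-term recurrence becomes
  \<open>\<Phi>(P\<^sub>n\<^sub>+\<^sub>1) = A \<Phi>(P\<^sub>n) - q\<^sup>n x \<Phi>(P\<^sub>n) + s [n]\<^sub>q (\<Phi>(P\<^sub>n\<^sub>-\<^sub>1) - \<eta> \<Phi>(P\<^sub>n\<^sub>-\<^sub>1))\<close>.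
  Since \<open>\<Phi>(P\<^sub>1) = A 1 - x = 0\<close> and \<open>\<eta>\<close> fixes constants, \<open>\<Phi>(P\<^sub>n) = 0\<close> for all \<open>n > 0\<close> by
  induction.
\<close>

section \<open>The q-derivative\<close>

text \<open>
  Identities for \<open>D\<^sub>q\<close> are proved by clearing the denominator, which avoids polynomial division.
\<close>

lemma q_deriv_unique:
  assumes "q \<noteq> 1" "[:0, 1 - q:] * g = f - pcompose f [:0, q:]"
  shows "q_deriv q f = g"
  using assms q_deriv_mult[OF assms(1), of f] by (metis diff_eq_diff_eq diff_self
    mult_cancel_left pCons_eq_0_iff)

lemma q_deriv_add:
  assumes "q \<noteq> 1"
  shows "q_deriv q (f + g) = q_deriv q f + q_deriv q g"
  by (rule q_deriv_unique[OF assms])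
    (simp add: distrib_left q_deriv_mult[OF assms] pcompose_add del: mult_pCons_left)

lemma q_deriv_smult:
  assumes "q \<noteq> 1"
  shows "q_deriv q (smult c f) = smult c (q_deriv q f)"
  by (rule q_deriv_unique[OF assms])
    (simp add: q_deriv_mult[OF assms] pcompose_smult smult_diff_right del: mult_pCons_left)

lemma q_deriv_0: "q_deriv q 0 = 0"
  by (simp add: q_deriv_def)

lemma q_deriv_1: "q_deriv q 1 = 0"
  by (simp add: q_deriv_def one_pCons pcompose_pCons)

lemma q_deriv_sum:
  assumes "q \<noteq> 1"
  shows "q_deriv q (\<Sum>i\<in>S. f i) = (\<Sum>i\<in>S. q_deriv q (f i))"
  by (induction S rule: infinite_finite_induct) (simp_all add: q_deriv_0 q_deriv_add[OF assms])

text \<open>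
  Of the two forms of the Leibniz rule, the one in which the shift acts on the second factor
  leaves the operator \<open>x - s D\<^sub>q\<close> acting on \<open>g\<close> next to an unshifted coefficient \<open>f\<close>.
\<close>

lemma q_deriv_times:
  assumes "q \<noteq> 1"
  shows "q_deriv q (f * g) = q_deriv q f * pcompose g [:0, q:] + f * q_deriv q g"
proof (rule q_deriv_unique[OF assms])
  have "[:0, 1 - q:] * (q_deriv q f * pcompose g [:0, q:] + f * q_deriv q g)
      = ([:0, 1 - q:] * q_deriv q f) * pcompose g [:0, q:] + f * ([:0, 1 - q:] * q_deriv q g)"
    by (simp only: distrib_left mult.assoc mult.left_commute)
  also have "\<dots> = f * g - pcompose (f * g) [:0, q:]"
    unfolding q_deriv_mult[OF assms] pcompose_mult by (simp add: algebra_simps)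
  finally show "[:0, 1 - q:] * (q_deriv q f * pcompose g [:0, q:] + f * q_deriv q g)
      = f * g - pcompose (f * g) [:0, q:]" .
qed

lemma q_deriv_X:
  assumes "q \<noteq> 1"
  shows "q_deriv q [:0, 1:] = 1"
  by (rule q_deriv_unique[OF assms]) (simp add: pcompose_pCons)

section \<open>The q-derivative of the Al-Salam-Chihara polynomials\<close>

abbreviation hermite_asc :: "'k::field \<Rightarrow> 'k \<Rightarrow> nat \<Rightarrow> 'k poly poly" where
  "hermite_asc s q \<equiv> al_salam_chihara q [:0, 1:] 0 [:- s:]"

lemma hermite_asc_Suc_Suc:
  "hermite_asc s q (Suc (Suc n)) =
     pCons 0 (hermite_asc s q (Suc n))
     - smult (smult (q ^ Suc n) [:0, 1:]) (hermite_asc s q (Suc n))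
     + smult [:s * q_bracket q (Suc n):] (hermite_asc s q n)"
  by (simp add: left_diff_distrib mult.commute[of s] flip: smult_minus_left)

lemma q_bracket_Suc: "q \<noteq> 1 \<Longrightarrow> q_bracket q (Suc n) = q_bracket q n + q ^ n"
  by (simp add: q_bracket_def field_simps)

lemma q_bracket_1: "q \<noteq> 1 \<Longrightarrow> q_bracket q (Suc 0) = 1"
  by (simp add: q_bracket_def)

text \<open>
  This is \<open>D\<^sub>q P\<^sub>n\<^sub>+\<^sub>1 = - [n+1]\<^sub>q \<eta> P\<^sub>n\<close>, read coefficientwise in \<open>z\<close> so that \<open>D\<^sub>q\<close> and \<open>\<eta>\<close>
  act on polynomials in \<open>x\<close> only. In the induction step, applying \<open>D\<^sub>q\<close> to the recurrence of \<open>P\<^sub>n\<^sub>+\<^sub>2\<close> gives \<open>- [n+1]\<^sub>q\<close> times the shifted recurrence of \<open>P\<^sub>n\<^sub>+\<^sub>1\<close>, because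
  \<open>\<eta>\<close> turns its coefficient \<open>x q\<^sup>n\<close> into \<open>x q\<^sup>n\<^sup>+\<^sup>1\<close> and the induction hypotheses supply
  \<open>[n+1]\<^sub>q [n]\<^sub>q\<close> in front of \<open>s \<eta> P\<^sub>n\<^sub>-\<^sub>1\<close>. The Leibniz rule for
  \<open>x q\<^sup>n\<^sup>+\<^sup>1 P\<^sub>n\<^sub>+\<^sub>1\<close> contributes a further \<open>- q\<^sup>n\<^sup>+\<^sup>1 \<eta> P\<^sub>n\<^sub>+\<^sub>1\<close>, and
  \<open>[n+1]\<^sub>q + q\<^sup>n\<^sup>+\<^sup>1 = [n+2]\<^sub>q\<close>.
\<close>

lemma q_deriv_coeff_asc:
  fixes s q :: "'k::field"
  assumes q: "q \<noteq> 1"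
  shows "q_deriv q (coeff (hermite_asc s q (Suc n)) i)
       = - smult (q_bracket q (Suc n)) (pcompose (coeff (hermite_asc s q n) i) [:0, q:])"
proof (induction n arbitrary: i rule: less_induct)
  case (less n)
  define P where "P = hermite_asc s q"
  define D where "D = q_deriv q"
  define E where "E = (\<lambda>f::'k poly. pcompose f [:0, q:])"
  define X where "X = ([:0, 1:] :: 'k poly)"
  define Z where "Z = (\<lambda>m. coeff (pCons 0 (P m)) i)"
  have IH: "D (coeff (P (Suc m)) j) = - smult (q_bracket q (Suc m)) (E (coeff (P m) j))"
    if "m < n" for m j
    using less.IH[OF that] by (simp only: P_def D_def E_def)
  have D_add: "D (f + g) = D f + D g" and D_smult: "D (smult c f) = smult c (D f)"
    and D_0: "D 0 = 0" and D_X: "D X = 1" and D_times: "D (f * g) = D f * E g + f * D g"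
    for f g c
    by (simp_all only: D_def E_def X_def q_deriv_add[OF q] q_deriv_smult[OF q] q_deriv_0
        q_deriv_X[OF q] q_deriv_times[OF q])
  have E_add: "E (f + g) = E f + E g" and E_smult: "E (smult c f) = smult c (E f)"
    and E_0: "E 0 = 0" and E_X: "E X = smult q X" and E_times: "E (f * g) = E f * E g"
    for f g c
    by (simp_all add: E_def X_def pcompose_add pcompose_smult pcompose_mult pcompose_pCons)
  have rec: "coeff (P (Suc (Suc m))) i = Z (Suc m) + smult (- (q ^ Suc m)) (X * coeff (P (Suc m)) i)
      + smult (s * q_bracket q (Suc m)) (coeff (P m) i)" for m
    unfolding P_def hermite_asc_Suc_Suc by (simp add: Z_def X_def P_def)
  have rec0: "coeff (P (Suc 0)) i = Z 0 + smult (- 1) (X * coeff (P 0) i)"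
    by (simp add: P_def Z_def X_def coeff_pCons one_pCons split: nat.split)
  have D_Z: "D (Z (Suc m)) = - smult (q_bracket q (Suc m)) (E (Z m))" if "m < n" for m
    using IH[OF that] by (simp add: Z_def coeff_pCons D_0 E_0 split: nat.split)
  have D_P0: "D (coeff (P 0) j) = 0" for j
    by (simp add: P_def D_def coeff_pCons one_pCons q_deriv_0 q_deriv_1[unfolded one_pCons]
        split: nat.split)
  have D_Z0: "D (Z 0) = 0"
    using D_P0 by (simp add: Z_def coeff_pCons D_0 split: nat.split)
  have "D (coeff (P (Suc n)) i) = - smult (q_bracket q (Suc n)) (E (coeff (P n) i))"
  proof (cases n)
    case 0
    show ?thesis
      unfolding 0 rec0 D_add D_smult D_times D_X D_P0 D_Z0 by (simp add: q_bracket_1[OF q])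
  next
    case (Suc k)
    show ?thesis
    proof (cases k)
      case 0
      have n: "n = Suc 0" using Suc 0 by simp
      have Eq: "E (coeff (P (Suc 0)) i) = E (Z 0) + smult (- q) (X * E (coeff (P 0) i))"
        unfolding rec0 E_add E_smult E_times E_X by simp
      show ?thesis
        unfolding n rec D_add D_smult D_times D_X D_P0
          D_Z[of 0, unfolded n, OF lessI] IH[of 0 i, unfolded n, OF lessI]
          q_bracket_Suc[OF q, of "Suc 0"] q_bracket_1[OF q] Eq
        by (simp add: smult_add_left smult_add_right smult_diff_right algebra_simps)
    next
      case (Suc l)
      have n: "n = Suc (Suc l)" using \<open>n = Suc k\<close> Suc by simp
      have Eq: "E (coeff (P (Suc (Suc l))) i) = E (Z (Suc l))
        + smult (- (q ^ Suc (Suc l))) (X * E (coeff (P (Suc l)) i))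
        + smult (s * q_bracket q (Suc l)) (E (coeff (P l) i))"
        unfolding rec E_add E_smult E_times E_X by (simp add: mult.commute)
      have "D (coeff (P (Suc n)) i)
        = - smult (q_bracket q n) (E (coeff (P n) i)) - smult (q ^ n) (E (coeff (P n) i))"
        unfolding n rec[of "Suc l"] D_add D_smult D_times D_X
          D_Z[of "Suc l", unfolded n, OF lessI] IH[of "Suc l" i, unfolded n, OF lessI]
          IH[of l i, unfolded n, OF less_SucI[OF lessI]]
        unfolding Eq
        by (simp add: smult_add_right smult_diff_right algebra_simps)
      then show ?thesis
        by (simp add: q_bracket_Suc[OF q, of n] smult_add_left)
    qed
  qed
  then show ?case by (simp only: P_def D_def E_def)
qed

lemma smult_sum_right: "smult c (\<Sum>i\<in>S. f i) = (\<Sum>i\<in>S. smult c (f i))"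
  by (induction S rule: infinite_finite_induct) (simp_all add: smult_add_right)

section \<open>The functional sending powers of z to iterates of an operator\<close>

definition power_functional ::
  "('k::field poly \<Rightarrow> 'k poly) \<Rightarrow> 'k poly poly \<Rightarrow> 'k poly" where
  "power_functional A f = (\<Sum>i\<le>degree f. coeff f i * (A ^^ i) 1)"

lemma power_functional_bound:
  assumes "degree f \<le> N"
  shows "power_functional A f = (\<Sum>i\<le>N. coeff f i * (A ^^ i) 1)"
  unfolding power_functional_def using assms
  by (intro sum.mono_neutral_left) (auto simp: coeff_eq_0)

lemma power_functional_add:
  "power_functional A (f + g) = power_functional A f + power_functional A g"
proof -
  let ?N = "max (degree f) (degree g)"
  have "power_functional A (f + g) = (\<Sum>i\<le>?N. coeff (f + g) i * (A ^^ i) 1)"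
    by (intro power_functional_bound degree_add_le_max)
  then show ?thesis
    by (simp add: power_functional_bound[of f ?N] power_functional_bound[of g ?N]
        sum.distrib algebra_simps)
qed

lemma power_functional_smult: "power_functional A (smult r f) = r * power_functional A f"
  by (subst power_functional_bound[of _ "degree f"])
    (simp_all add: power_functional_def sum_distrib_left mult.assoc degree_smult_le)

lemma power_functional_diff:
  "power_functional A (f - g) = power_functional A f - power_functional A g"
  using power_functional_add[of A "f - g" g] by simp

lemma power_functional_power: "power_functional A ([:0, 1:] ^ n) = (A ^^ n) 1"
proof -
  have "[:0, 1:] ^ n = (monom 1 n :: 'a poly poly)"
    by (simp add: monom_altdef)
  then show ?thesis
    by (simp add: power_functional_bound[of "monom 1 n" n] degree_monom_le if_distrib if_distribR
        sum.delta cong: if_cong)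
qed

abbreviation hermite_op :: "'k::field \<Rightarrow> 'k \<Rightarrow> 'k poly \<Rightarrow> 'k poly" where
  "hermite_op s q \<equiv> \<lambda>f. [:0, 1:] * f - smult s (q_deriv q f)"

text \<open>
  Moving the coefficients of \<open>f\<close> to the left of the operator costs one Leibniz correction for
  each of them.
\<close>

lemma power_functional_pCons_0:
  assumes q: "q \<noteq> 1" and N: "degree f \<le> N"
  shows "power_functional (hermite_op s q) (pCons 0 f) =
    hermite_op s q (power_functional (hermite_op s q) f) +
    smult s (\<Sum>i\<le>N. q_deriv q (coeff f i) * pcompose ((hermite_op s q ^^ i) 1) [:0, q:])"
proof -
  define A where "A = hermite_op s q"
  have A: "f * A g = A (f * g) + smult s (q_deriv q f * pcompose g [:0, q:])" for f g
    unfolding A_def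
    by (simp add: q_deriv_times[OF q] algebra_simps smult_add_right del: mult_pCons_left mult_pCons_right)
  have A_sum: "A (\<Sum>i\<in>S. g i) = (\<Sum>i\<in>S. A (g i))" for S :: "nat set" and g
    unfolding A_def
    by (simp add: q_deriv_sum[OF q] sum_distrib_left smult_sum_right sum_subtractf
        del: mult_pCons_left mult_pCons_right)
  have "degree (pCons 0 f) \<le> Suc N"
    using N by (simp add: degree_pCons_eq_if)
  then have "power_functional A (pCons 0 f) = (\<Sum>i\<le>Suc N. coeff (pCons 0 f) i * (A ^^ i) 1)"
    by (rule power_functional_bound)
  also have "\<dots> = (\<Sum>i\<le>N. coeff f i * A ((A ^^ i) 1))"
    by (subst sum.atMost_Suc_shift) simp
  also have "\<dots> = A (\<Sum>i\<le>N. coeff f i * (A ^^ i) 1) +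
      smult s (\<Sum>i\<le>N. q_deriv q (coeff f i) * pcompose ((A ^^ i) 1) [:0, q:])"
    by (simp only: A sum.distrib A_sum smult_sum_right)
  also have "(\<Sum>i\<le>N. coeff f i * (A ^^ i) 1) = power_functional A f"
    by (rule power_functional_bound[OF N, symmetric])
  finally show ?thesis
    by (simp only: A_def)
qed

text \<open>
  Since \<open>\<eta>\<close> is a ring homomorphism, the Appell identity collects the Leibniz corrections into the
  shift of a single value of the functional.
\<close>

lemma power_functional_pCons_0_asc:
  assumes q: "q \<noteq> 1"
  shows "power_functional (hermite_op s q) (pCons 0 (hermite_asc s q (Suc n))) =
    hermite_op s q (power_functional (hermite_op s q) (hermite_asc s q (Suc n))) -
    smult (s * q_bracket q (Suc n))
      (pcompose (power_functional (hermite_op s q) (hermite_asc s q n)) [:0, q:])"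
proof -
  have deg: "degree (hermite_asc s q m) = m" for m
    using al_salam_chihara_monic by blast
  have "power_functional (hermite_op s q) (hermite_asc s q n)
      = (\<Sum>i\<le>Suc n. coeff (hermite_asc s q n) i * (hermite_op s q ^^ i) 1)"
    by (rule power_functional_bound) (simp add: deg)
  then have "(\<Sum>i\<le>Suc n. q_deriv q (coeff (hermite_asc s q (Suc n)) i) *
        pcompose ((hermite_op s q ^^ i) 1) [:0, q:])
      = - smult (q_bracket q (Suc n))
          (pcompose (power_functional (hermite_op s q) (hermite_asc s q n)) [:0, q:])"
    by (simp only: q_deriv_coeff_asc[OF q] pcompose_sum pcompose_mult smult_sum_right mult_smult_left
        mult_minus_left sum_negf)
  then show ?thesis
    using power_functional_pCons_0[OF q eq_refl[OF deg], of s "Suc n"] by simp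
qed

lemma power_functional_asc:
  assumes q: "q \<noteq> 1"
  shows "power_functional (hermite_op s q) (hermite_asc s q n) = (if n = 0 then 1 else 0)"
proof (induction n rule: less_induct)
  case (less n)
  let ?L = "power_functional (hermite_op s q)"
  consider "n = 0" | "n = Suc 0" | m where "n = Suc (Suc m)"
    by (metis not0_implies_Suc)
  then show ?case
  proof cases
    case 1
    then show ?thesis by (simp add: power_functional_def)
  next
    case 2
    then show ?thesis by (simp add: power_functional_def q_deriv_1[unfolded one_pCons] one_pCons)
  next
    case 3
    have L1: "?L (hermite_asc s q (Suc m)) = 0"
      using less.IH[of "Suc m"] 3 by simp
    \<comment> \<open>Both 0 and 1 are constants, so the shift does not change this value.\<close>
    have L0: "pcompose (?L (hermite_asc s q m)) [:0, q:] = ?L (hermite_asc s q m)"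
      using less.IH[of m] 3 by (simp add: one_pCons)
    have "?L (hermite_asc s q n) = 0"
      unfolding 3 hermite_asc_Suc_Suc power_functional_add power_functional_diff
        power_functional_smult power_functional_pCons_0_asc[OF q] L1 L0
      by (simp add: q_deriv_0)
    then show ?thesis using 3 by simp
  qed
qed

lemma new_q_hermite_eq_iterate:
  assumes q: "q \<noteq> 1"
  shows "new_q_hermite s q n = (hermite_op s q ^^ n) 1"
proof -
  have "is_asc_functional q [:0, 1:] 0 [:- s:] (power_functional (hermite_op s q))"
    by (simp only: is_asc_functional_def power_functional_add power_functional_smult
        power_functional_asc[OF q] simp_thms)
  then have "asc_functional q [:0, 1:] 0 [:- s:] = power_functional (hermite_op s q)"
    unfolding asc_functional_def by (rule the1_equality[OF asc_functional_ex1])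
  then show ?thesis
    by (simp only: new_q_hermite_def power_functional_power)
qed

theorem theorem4:
  fixes n :: nat
  shows "new_q_hermite (indet_s :: 'a::field poly poly fract) indet_q n
         = ((\<lambda>f. [:0, 1:] * f - smult indet_s (q_deriv indet_q f)) ^^ n) 1"
  by (rule new_q_hermite_eq_iterate[OF indet_q_neq_1])

end
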